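(* Let $A$ and $A_1$ be $C^*$-algebras and let $\theta\colon A\to A_1$ be a proper $*$-homomorphism. Let $B,B_1,D$ be $C^{*,\tau}$-algebras, equip $A\oplus A^{\mathrm{op}}$ and $A_1\oplus A_1^{\mathrm{op}}$ with the $\tau$-operation that flips the summands, $(a_1,a_2)^\tau=(a_2,a_1)$, and define $\bar\theta\colon A\oplus A^{\mathrm{op}}\to A_1\oplus A_1^{\mathrm{op}}$ by $\bar\theta(a_1,a_2)=(\theta(a_1),\theta(a_2))$. Suppose that $$0\to A_1\oplus A_1^{\mathrm{op}}\xrightarrow{\ \iota_1\ }B_1\xrightarrow{\ p_1\ }D\to0,\qquad 0\to A\oplus A^{\mathrm{op}}\xrightarrow{\ \iota\ }B\xrightarrow{\ p\ }D\to0$$ are exact sequences of $C^{*,\tau}$-algebras and $*$-$\tau$-homomorphisms, and that $\beta\colon B\to B_1$ is a $*$-$\tau$-homomorphism with $\beta\circ\iota=\iota_1\circ\bar\theta$ and $p_1\circ\beta=p$. Let $E$ be a $C^{*,\tau}$-algebra and $\phi\colon B\to E$ a $*$-$\tau$-homomorphism. If there exists a $*$-homomorphism $\lambda\colon A_1\to E$ with $\lambda(\theta(a))=\phi(\iota(a,0))$ for all $a\in A$, then there exists a $*$-$\tau$-homomorphism $\psi\colon B_1\to E$ such that $\psi\circ\beta=\phi$.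
   Context: A $C^{*,\tau}$-algebra is a (complex) $C^*$-algebra together with a map $a\mapsto a^\tau$ (a reflection) that is linear, antimultiplicative ($(ab)^\tau=b^\tau a^\tau$), $*$-preserving ($(a^* )^\tau=(a^\tau)^*$) and involutive ($a^{\tau\tau}=a$). A $*$-$\tau$-homomorphism is a $*$-homomorphism preserving $\tau$. $A^{\mathrm{op}}$ is the opposite $C^*$-algebra: same underlying Banach space and involution as $A$, with reversed multiplication. A $*$-homomorphism $\theta\colon A\to B$ is proper if $\theta(A)B=B$, i.e. every element of $B$ is of the form $\theta(a)b$ with $a\in A$, $b\in B$ (equivalently, by factorization, the closed linear span of $\theta(A)B$ is $B$). *)

theory Defs
  imports Complex_Main
begin

section \<open>C*-algebras\<close>

text \<open>A C*-algebra is not assumed to be unital or nonzero.  The library has no class of complex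
  normed algebras, so the complex scalars are added to the real Banach algebra structure.\<close>

class cstar_algebra = real_normed_algebra + banach +
  fixes scaleC :: "complex \<Rightarrow> 'a \<Rightarrow> 'a"  (infixr \<open>*\<^sub>C\<close> 75)
    and star :: "'a \<Rightarrow> 'a"
  assumes scaleC_add_right: "c *\<^sub>C (x + y) = c *\<^sub>C x + c *\<^sub>C y"
    and scaleC_add_left: "(c + d) *\<^sub>C x = c *\<^sub>C x + d *\<^sub>C x"
    and scaleC_scaleC: "c *\<^sub>C (d *\<^sub>C x) = (c * d) *\<^sub>C x"
    and scaleR_scaleC: "r *\<^sub>R x = complex_of_real r *\<^sub>C x"
    and scaleC_mult_left: "(c *\<^sub>C x) * y = c *\<^sub>C (x * y)"
    and scaleC_mult_right: "x * (c *\<^sub>C y) = c *\<^sub>C (x * y)"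
    and norm_scaleC: "norm (c *\<^sub>C x) = cmod c * norm x"
    and star_add: "star (x + y) = star x + star y"
    and star_scaleC: "star (c *\<^sub>C x) = cnj c *\<^sub>C star x"
    and star_mult: "star (x * y) = star y * star x"
    and star_star: "star (star x) = x"
    and cstar_identity: "norm (star x * x) = (norm x)\<^sup>2"

lemma norm_star: "norm (star x) = norm (x :: 'a :: cstar_algebra)"
proof -
  have le: "norm y \<le> norm (star y)" for y :: 'a
  proof (cases "norm y = 0")
    case False
    have "norm y * norm y \<le> norm (star y) * norm y"
      using norm_mult_ineq[of "star y" y] by (simp add: cstar_identity power2_eq_square)
    with False show ?thesis by simp
  qed simp
  show ?thesis using le[of x] le[of "star x"] by (simp add: star_star)
qed

definition star_hom :: "('a :: cstar_algebra \<Rightarrow> 'b :: cstar_algebra) \<Rightarrow> bool" where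
  "star_hom f \<longleftrightarrow>
     (\<forall>x y. f (x + y) = f x + f y) \<and>
     (\<forall>c x. f (c *\<^sub>C x) = c *\<^sub>C f x) \<and>
     (\<forall>x y. f (x * y) = f x * f y) \<and>
     (\<forall>x. f (star x) = star (f x))"

definition proper_hom :: "('a :: cstar_algebra \<Rightarrow> 'b :: cstar_algebra) \<Rightarrow> bool" where
  "proper_hom f \<longleftrightarrow> star_hom f \<and> (\<forall>y. \<exists>a b. y = f a * b)"

definition short_exact ::
    "('a :: cstar_algebra \<Rightarrow> 'b :: cstar_algebra) \<Rightarrow> ('b \<Rightarrow> 'c :: cstar_algebra) \<Rightarrow> bool" where
  "short_exact i p \<longleftrightarrow> inj i \<and> range i = {x. p x = 0} \<and> surj p"

section \<open>Reflections\<close>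

text \<open>A C*-tau-algebra is a type of class \<open>cstar_algebra\<close> together with a map \<open>\<tau>\<close> satisfying
  \<open>reflection \<tau>\<close>.\<close>

definition reflection :: "('a :: cstar_algebra \<Rightarrow> 'a) \<Rightarrow> bool" where
  "reflection \<tau> \<longleftrightarrow>
     (\<forall>x y. \<tau> (x + y) = \<tau> x + \<tau> y) \<and>
     (\<forall>c x. \<tau> (c *\<^sub>C x) = c *\<^sub>C \<tau> x) \<and>
     (\<forall>x y. \<tau> (x * y) = \<tau> y * \<tau> x) \<and>
     (\<forall>x. \<tau> (star x) = star (\<tau> x)) \<and>
     (\<forall>x. \<tau> (\<tau> x) = x)"

definition star_tau_hom ::
    "('a :: cstar_algebra \<Rightarrow> 'a) \<Rightarrow> ('b :: cstar_algebra \<Rightarrow> 'b) \<Rightarrow> ('a \<Rightarrow> 'b) \<Rightarrow> bool" where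
  "star_tau_hom \<tau> \<sigma> f \<longleftrightarrow> star_hom f \<and> (\<forall>x. f (\<tau> x) = \<sigma> (f x))"

section \<open>The opposite C*-algebra\<close>

datatype 'a opposite = Opp (unopp: 'a)

instantiation opposite :: (cstar_algebra) real_normed_algebra
begin

definition "0 = Opp 0"
definition "x + y = Opp (unopp x + unopp y)"
definition "x - y = Opp (unopp x - unopp y)"
definition "- x = Opp (- unopp x)"
definition "x * y = Opp (unopp y * unopp x)"
definition "r *\<^sub>R x = Opp (r *\<^sub>R unopp x)"
definition "norm x = norm (unopp x)"
definition "dist (x :: 'a opposite) y = norm (x - y)"
definition "sgn (x :: 'a opposite) = inverse (norm x) *\<^sub>R x"
definition "(uniformity :: ('a opposite \<times> 'a opposite) filter) =
  (INF e\<in>{0<..}. principal {(x, y). dist x y < e})"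
definition "open (U :: 'a opposite set) \<longleftrightarrow>
  (\<forall>x\<in>U. \<forall>\<^sub>F (x', y) in uniformity. x' = x \<longrightarrow> y \<in> U)"

lemmas opposite_ops =
  zero_opposite_def plus_opposite_def minus_opposite_def uminus_opposite_def times_opposite_def
  scaleR_opposite_def norm_opposite_def

instance
proof
  fix x y z :: "'a opposite" and r s :: real and U :: "'a opposite set"
  show "dist x y = norm (x - y)" "sgn x = inverse (norm x) *\<^sub>R x"
    "(uniformity :: ('a opposite \<times> 'a opposite) filter) =
       (INF e\<in>{0<..}. principal {(x, y). dist x y < e})"
    "open U \<longleftrightarrow> (\<forall>x\<in>U. \<forall>\<^sub>F (x', y) in uniformity. x' = x \<longrightarrow> y \<in> U)"
    by (fact dist_opposite_def sgn_opposite_def uniformity_opposite_def open_opposite_def)+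
  show "norm (x * y) \<le> norm x * norm y"
    using norm_mult_ineq[of "unopp y" "unopp x"] by (simp add: opposite_ops mult.commute)
  show "norm x = 0 \<longleftrightarrow> x = 0" by (cases x) (simp add: opposite_ops)
qed (simp_all add: opposite_ops algebra_simps norm_triangle_ineq)

end

instance opposite :: (cstar_algebra) banach
proof
  fix X :: "nat \<Rightarrow> 'a opposite" assume "Cauchy X"
  then have "Cauchy (\<lambda>n. unopp (X n))"
    by (simp add: Cauchy_def dist_norm opposite_ops)
  then obtain l where "(\<lambda>n. unopp (X n)) \<longlonglongrightarrow> l"
    using Cauchy_convergent convergent_def by blast
  then have "X \<longlonglongrightarrow> Opp l"
    by (simp add: LIMSEQ_def dist_norm opposite_ops)
  then show "convergent X" by (auto simp: convergent_def)
qed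

instantiation opposite :: (cstar_algebra) cstar_algebra
begin

definition "c *\<^sub>C x = Opp (c *\<^sub>C unopp x)"
definition "star x = Opp (star (unopp x))"

instance
proof
  fix x :: "'a opposite"
  show "norm (star x * x) = (norm x)\<^sup>2"
    using cstar_identity[of "star (unopp x)"]
    by (simp add: opposite_ops star_opposite_def star_star norm_star)
qed (simp_all add: opposite_ops scaleC_opposite_def star_opposite_def
    scaleC_add_right scaleC_add_left scaleC_scaleC scaleR_scaleC scaleC_mult_left scaleC_mult_right
    norm_scaleC star_add star_scaleC star_mult star_star)

end

section \<open>Direct sums\<close>

text \<open>The product type of the library carries the Euclidean norm, which violates the C*-identity;
  the direct sum of C*-algebras needs the maximum norm, hence a type of its own.\<close>

datatype ('a, 'b) dsum = DSum (dfst: 'a) (dsnd: 'b)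

instantiation dsum :: (cstar_algebra, cstar_algebra) real_normed_algebra
begin

definition "0 = DSum 0 0"
definition "x + y = DSum (dfst x + dfst y) (dsnd x + dsnd y)"
definition "x - y = DSum (dfst x - dfst y) (dsnd x - dsnd y)"
definition "- x = DSum (- dfst x) (- dsnd x)"
definition "x * y = DSum (dfst x * dfst y) (dsnd x * dsnd y)"
definition "r *\<^sub>R x = DSum (r *\<^sub>R dfst x) (r *\<^sub>R dsnd x)"
definition "norm x = max (norm (dfst x)) (norm (dsnd x))"
definition "dist (x :: ('a, 'b) dsum) y = norm (x - y)"
definition "sgn (x :: ('a, 'b) dsum) = inverse (norm x) *\<^sub>R x"
definition "(uniformity :: (('a, 'b) dsum \<times> ('a, 'b) dsum) filter) =
  (INF e\<in>{0<..}. principal {(x, y). dist x y < e})"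
definition "open (U :: ('a, 'b) dsum set) \<longleftrightarrow>
  (\<forall>x\<in>U. \<forall>\<^sub>F (x', y) in uniformity. x' = x \<longrightarrow> y \<in> U)"

lemmas dsum_ops =
  zero_dsum_def plus_dsum_def minus_dsum_def uminus_dsum_def times_dsum_def
  scaleR_dsum_def norm_dsum_def

instance
proof
  fix x y z :: "('a, 'b) dsum" and r s :: real and U :: "('a, 'b) dsum set"
  show "dist x y = norm (x - y)" "sgn x = inverse (norm x) *\<^sub>R x"
    "(uniformity :: (('a, 'b) dsum \<times> ('a, 'b) dsum) filter) =
       (INF e\<in>{0<..}. principal {(x, y). dist x y < e})"
    "open U \<longleftrightarrow> (\<forall>x\<in>U. \<forall>\<^sub>F (x', y) in uniformity. x' = x \<longrightarrow> y \<in> U)"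
    by (fact dist_dsum_def sgn_dsum_def uniformity_dsum_def open_dsum_def)+
  show "norm x = 0 \<longleftrightarrow> x = 0"
    using norm_ge_zero[of "dfst x"] norm_ge_zero[of "dsnd x"]
    by (cases x) (auto simp: dsum_ops max_def)
  show "norm (x + y) \<le> norm x + norm y"
    using norm_triangle_ineq[of "dfst x" "dfst y"] norm_triangle_ineq[of "dsnd x" "dsnd y"]
    by (auto simp: dsum_ops)
  show "norm (r *\<^sub>R x) = \<bar>r\<bar> * norm x"
    by (simp add: dsum_ops max_mult_distrib_left)
  show "norm (x * y) \<le> norm x * norm y"
    by (simp add: dsum_ops order_trans[OF norm_mult_ineq] mult_mono')
qed (simp_all add: dsum_ops algebra_simps)

end

instance dsum :: (cstar_algebra, cstar_algebra) banach
proof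
  fix X :: "nat \<Rightarrow> ('a, 'b) dsum" assume X: "Cauchy X"
  then have "Cauchy (\<lambda>n. dfst (X n))" "Cauchy (\<lambda>n. dsnd (X n))"
    by (simp_all add: Cauchy_def dist_norm dsum_ops) blast+
  then obtain k l where k: "(\<lambda>n. dfst (X n)) \<longlonglongrightarrow> k" and l: "(\<lambda>n. dsnd (X n)) \<longlonglongrightarrow> l"
    using Cauchy_convergent convergent_def by metis
  have "X \<longlonglongrightarrow> DSum k l"
  proof (rule metric_LIMSEQ_I)
    fix r :: real assume "0 < r"
    with k l obtain M N where "\<forall>n\<ge>M. dist (dfst (X n)) k < r" "\<forall>n\<ge>N. dist (dsnd (X n)) l < r"
      by (meson metric_LIMSEQ_D)
    then show "\<exists>no. \<forall>n\<ge>no. dist (X n) (DSum k l) < r"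
      by (intro exI[of _ "max M N"]) (simp add: dist_norm dsum_ops)
  qed
  then show "convergent X" by (auto simp: convergent_def)
qed

instantiation dsum :: (cstar_algebra, cstar_algebra) cstar_algebra
begin

definition "c *\<^sub>C x = DSum (c *\<^sub>C dfst x) (c *\<^sub>C dsnd x)"
definition "star x = DSum (star (dfst x)) (star (dsnd x))"

instance
proof
  fix x :: "('a, 'b) dsum" and c :: complex
  show "norm (star x * x) = (norm x)\<^sup>2"
    by (simp add: dsum_ops star_dsum_def cstar_identity max_def power_mono_iff)
  show "norm (c *\<^sub>C x) = cmod c * norm x"
    by (simp add: dsum_ops scaleC_dsum_def norm_scaleC max_mult_distrib_left)
qed (simp_all add: dsum_ops scaleC_dsum_def star_dsum_def
    scaleC_add_right scaleC_add_left scaleC_scaleC scaleR_scaleC scaleC_mult_left scaleC_mult_right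
    star_add star_scaleC star_mult star_star)

end

section \<open>The double of a C*-algebra\<close>

type_synonym 'a double = "('a, 'a opposite) dsum"

fun flip :: "'a double \<Rightarrow> 'a double" where
  "flip (DSum a (Opp b)) = DSum b (Opp a)"

fun double_map :: "('a \<Rightarrow> 'b) \<Rightarrow> 'a double \<Rightarrow> 'b double" where
  "double_map f (DSum a (Opp b)) = DSum (f a) (Opp (f b))"

lemma reflection_flip: "reflection (flip :: 'a :: cstar_algebra double \<Rightarrow> _)"
proof -
  have "flip x = DSum (unopp (dsnd x)) (Opp (dfst x))" for x :: "'a double"
    by (cases x rule: flip.cases) simp
  then show ?thesis
    by (simp add: reflection_def dsum_ops opposite_ops scaleC_dsum_def scaleC_opposite_def
        star_dsum_def star_opposite_def)
qed

end

theory Submission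
  imports Defs
begin

text \<open>The formula \<open>\<mu> (x, y) = \<lambda> x + (\<lambda> y)\<^sup>\<tau>\<close> extends \<open>\<lambda>\<close> to the double of \<open>A\<^sub>1\<close>: the two
  summands annihilate each other because \<open>\<theta>\<close> is proper and they do so on the range of \<open>\<theta>\<close>.
  Since \<open>B\<^sub>1\<close> is the sum of the range of \<open>\<beta>\<close> and its ideal, \<open>\<psi> (\<beta> b + \<iota>\<^sub>1 x) = \<phi> b + \<mu> x\<close> is forced.
  Exactness makes it well defined, and it is multiplicative on mixed products because,
  by properness, every element of the ideal factors through the range of \<open>\<theta>\<close>.\<close>

lemma star_homD:
  assumes "star_hom f"
  shows "f (x + y) = f x + f y" "f (c *\<^sub>C x) = c *\<^sub>C f x" "f (x * y) = f x * f y"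
    "f (star x) = star (f x)"
  using assms by (auto simp: star_hom_def)

lemma star_hom_zero: "star_hom f \<Longrightarrow> f 0 = 0"
  using star_homD(1)[of f 0 0] by simp

lemma star_hom_diff: "star_hom f \<Longrightarrow> f (x - y) = f x - f y"
  using star_homD(1)[of f "x - y" y] by (simp add: eq_diff_eq)

lemma reflectionD:
  assumes "reflection \<tau>"
  shows "\<tau> (x + y) = \<tau> x + \<tau> y" "\<tau> (c *\<^sub>C x) = c *\<^sub>C \<tau> x" "\<tau> (x * y) = \<tau> y * \<tau> x"
    "\<tau> (star x) = star (\<tau> x)" "\<tau> (\<tau> x) = x"
  using assms by (auto simp: reflection_def)

lemma reflection_zero: "reflection \<tau> \<Longrightarrow> \<tau> 0 = 0"
  using reflectionD(1)[of \<tau> 0 0] by simp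

lemma proper_hom_left: "proper_hom f \<Longrightarrow> \<exists>a b. y = f a * b"
  by (auto simp: proper_hom_def)

text \<open>Factor \<open>star y\<close> on the left and take adjoints.\<close>

lemma proper_hom_right:
  assumes "proper_hom f"
  shows "\<exists>a b. y = b * f a"
proof -
  have "star_hom f" using assms by (simp add: proper_hom_def)
  obtain a b where "star y = f a * b" using proper_hom_left[OF assms] by blast
  then have "y = star b * f (star a)"
    by (metis star_star star_mult star_homD(4)[OF \<open>star_hom f\<close>])
  then show ?thesis by blast
qed

lemma double_cases:
  fixes x :: "'a double"
  obtains a b where "x = DSum a (Opp b)"
  by (cases x rule: flip.cases)

lemma double_simps:
  "DSum a (Opp b) + DSum c (Opp d) = DSum (a + c) (Opp (b + d))"
  "DSum a (Opp b) * DSum c (Opp d) = DSum (a * c) (Opp (d * b))"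
  "k *\<^sub>C DSum a (Opp b) = DSum (k *\<^sub>C a) (Opp (k *\<^sub>C b))"
  "star (DSum a (Opp b)) = DSum (star a) (Opp (star b))"
  "0 = DSum 0 (Opp 0)"
  by (simp_all add: dsum_ops opposite_ops scaleC_dsum_def scaleC_opposite_def
      star_dsum_def star_opposite_def)

text \<open>Multiplication in the opposite summand is reversed, so a left factorization there is a
  right factorization in the original algebra; this is where \<open>proper_hom_right\<close>
  enters.\<close>

lemma proper_hom_double_map:
  fixes f :: "'a :: cstar_algebra \<Rightarrow> 'b :: cstar_algebra"
  assumes "proper_hom f"
  shows "proper_hom (double_map f)"
  unfolding proper_hom_def
proof
  have "star_hom f" using assms by (simp add: proper_hom_def)
  note f = star_homD[OF this]
  show "star_hom (double_map f)"
    unfolding star_hom_def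
  proof (intro conjI allI)
    fix x y :: "'a double" and c
    obtain a b where x: "x = DSum a (Opp b)" by (rule double_cases)
    obtain a' b' where y: "y = DSum a' (Opp b')" by (rule double_cases)
    show "double_map f (x + y) = double_map f x + double_map f y"
      "double_map f (c *\<^sub>C x) = c *\<^sub>C double_map f x"
      "double_map f (x * y) = double_map f x * double_map f y"
      "double_map f (star x) = star (double_map f x)"
      by (simp_all add: x y double_simps f)
  qed
  show "\<forall>y. \<exists>a b. y = double_map f a * b"
  proof
    fix y :: "'b double"
    obtain u v where y: "y = DSum u (Opp v)" by (rule double_cases)
    obtain a b where u: "u = f a * b" using proper_hom_left[OF assms] by blast
    obtain a' b' where v: "v = b' * f a'" using proper_hom_right[OF assms] by blast
    have "y = double_map f (DSum a (Opp a')) * DSum b (Opp b')"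
      by (simp add: y u v double_simps)
    then show "\<exists>a b. y = double_map f a * b" by blast
  qed
qed

text \<open>This is the part of the construction free of reflections; it is applied with
  \<open>double_map \<theta>\<close> in the role of \<theta>. The last two conclusions let the
  caller verify further properties of \<psi> on the two kinds of summands.\<close>

lemma short_exact_pushout:
  assumes \<theta>: "proper_hom \<theta>"
    and \<iota>1: "star_hom \<iota>1" and p1: "star_hom p1" and ex1: "short_exact \<iota>1 p1"
    and \<iota>: "star_hom \<iota>" and p: "star_hom p" and ex: "short_exact \<iota> p"
    and \<beta>: "star_hom \<beta>"
    and \<beta>\<iota>: "\<And>z. \<beta> (\<iota> z) = \<iota>1 (\<theta> z)" and p\<beta>: "\<And>b. p1 (\<beta> b) = p b"
    and \<phi>: "star_hom \<phi>" and \<mu>: "star_hom \<mu>"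
    and \<mu>\<theta>: "\<And>z. \<mu> (\<theta> z) = \<phi> (\<iota> z)"
  obtains \<psi> where "star_hom \<psi>" "\<And>b. \<psi> (\<beta> b) = \<phi> b" "\<And>x. \<psi> (\<iota>1 x) = \<mu> x"
    "\<And>y. \<exists>b x. y = \<beta> b + \<iota>1 x"
proof -
  have inj1: "\<iota>1 x = \<iota>1 y \<longleftrightarrow> x = y" for x y
    using ex1 by (auto simp: short_exact_def inj_def)
  have ker1: "\<exists>x. y = \<iota>1 x" if "p1 y = 0" for y
    using ex1 that by (auto simp: short_exact_def)
  have ker: "\<exists>x. y = \<iota> x" if "p y = 0" for y
    using ex that by (auto simp: short_exact_def)
  have p\<iota>: "p (\<iota> x) = 0" for x
    using ex by (auto simp: short_exact_def)
  have decomp: "\<exists>b x. y = \<beta> b + \<iota>1 x" for y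
  proof -
    have "surj p" using ex by (simp add: short_exact_def)
    then obtain b where "p1 y = p b" by (meson surjD)
    then have "p1 (y - \<beta> b) = 0" by (simp add: star_hom_diff[OF p1] p\<beta>)
    then obtain x where "y - \<beta> b = \<iota>1 x" using ker1 by blast
    then have "y = \<beta> b + \<iota>1 x" by (simp add: algebra_simps)
    then show ?thesis by blast
  qed
  \<comment> \<open>The decomposition is not unique; \<open>bf\<close> and \<open>xf\<close> pick
    one arbitrarily, and \<open>wd0\<close> shows that the choice is immaterial.\<close>
  then obtain bf xf where dec: "\<And>y. y = \<beta> (bf y) + \<iota>1 (xf y)" by metis
  define \<psi> where "\<psi> y = \<phi> (bf y) + \<mu> (xf y)" for y
  \<comment> \<open>Two decompositions of one element differ by such a pair. Here p b = p1 (\<beta>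
    b) = 0, so b comes from the smaller ideal, where \<phi> and \<mu> are tied together by
    \<open>\<mu>\<theta>\<close>.\<close>
  have wd0: "\<phi> b = \<mu> x" if "\<beta> b = \<iota>1 x" for b x
  proof -
    have "p b = 0"
      using ex1 that by (auto simp: short_exact_def p\<beta>[symmetric])
    then obtain z where b: "b = \<iota> z" using ker by blast
    then have "x = \<theta> z" using that by (simp add: \<beta>\<iota> inj1)
    then show ?thesis by (simp add: b \<mu>\<theta>)
  qed
  have \<psi>: "\<psi> (\<beta> b + \<iota>1 x) = \<phi> b + \<mu> x" for b x
  proof -
    let ?y = "\<beta> b + \<iota>1 x"
    have "\<beta> (b - bf ?y) = \<iota>1 (xf ?y - x)"
      using dec[of ?y] by (simp add: star_hom_diff[OF \<beta>] star_hom_diff[OF \<iota>1] algebra_simps)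
    from wd0[OF this] show ?thesis
      by (simp add: \<psi>_def star_hom_diff[OF \<phi>] star_hom_diff[OF \<mu>] algebra_simps)
  qed
  \<comment> \<open>Nothing is known directly about \<phi> b * \<mu> x. Splitting off \<theta> z
    from x lets b be absorbed into the ideal of the first extension, as b * \<iota> z = \<iota> w.
    The same witness \<theta> w * y must serve both equations.\<close>
  have mult_left: "\<exists>x'. \<beta> b * \<iota>1 x = \<iota>1 x' \<and> \<phi> b * \<mu> x = \<mu> x'" for b x
  proof -
    obtain z y where x: "x = \<theta> z * y" using proper_hom_left[OF \<theta>] by blast
    obtain w where w: "b * \<iota> z = \<iota> w"
      using ker[of "b * \<iota> z"] by (auto simp: star_homD[OF p] p\<iota>)
    have "\<beta> b * \<iota>1 x = \<beta> (b * \<iota> z) * \<iota>1 y"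
      by (simp add: x star_homD[OF \<iota>1] star_homD[OF \<beta>] \<beta>\<iota> mult.assoc)
    moreover have "\<phi> b * \<mu> x = \<phi> (b * \<iota> z) * \<mu> y"
      by (simp add: x star_homD[OF \<mu>] star_homD[OF \<phi>] \<mu>\<theta> mult.assoc)
    ultimately have "\<beta> b * \<iota>1 x = \<iota>1 (\<theta> w * y) \<and> \<phi> b * \<mu> x = \<mu> (\<theta> w * y)"
      by (simp add: w \<beta>\<iota> \<mu>\<theta> star_homD[OF \<iota>1] star_homD[OF \<mu>])
    then show ?thesis by blast
  qed
  have mult_right: "\<exists>x'. \<iota>1 x * \<beta> b = \<iota>1 x' \<and> \<mu> x * \<phi> b = \<mu> x'" for b x
  proof -
    obtain x' where "\<beta> (star b) * \<iota>1 (star x) = \<iota>1 x'" "\<phi> (star b) * \<mu> (star x) = \<mu> x'"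
      using mult_left by blast
    then have "\<iota>1 x * \<beta> b = \<iota>1 (star x') \<and> \<mu> x * \<phi> b = \<mu> (star x')"
      by (metis star_homD(4)[OF \<iota>1] star_homD(4)[OF \<mu>] star_homD(4)[OF \<beta>] star_homD(4)[OF \<phi>]
          star_mult star_star)
    then show ?thesis by blast
  qed
  have "star_hom \<psi>"
    unfolding star_hom_def
  proof (intro conjI allI)
    fix y y' and c
    obtain b x where y: "y = \<beta> b + \<iota>1 x" using decomp by blast
    obtain b' x' where y': "y' = \<beta> b' + \<iota>1 x'" using decomp by blast
    have "y + y' = \<beta> (b + b') + \<iota>1 (x + x')"
      by (simp add: y y' star_homD[OF \<iota>1] star_homD[OF \<beta>])
    \<comment> \<open>\<open>simp only\<close> first rewrites the sum as a single decomposed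
      element, before y and y' are unfolded; the other three operations follow the same
      pattern.\<close>
    then show "\<psi> (y + y') = \<psi> y + \<psi> y'"
      by (simp only: \<psi>) (simp add: y y' \<psi> star_homD[OF \<mu>] star_homD[OF \<phi>])
    have "c *\<^sub>C y = \<beta> (c *\<^sub>C b) + \<iota>1 (c *\<^sub>C x)"
      by (simp add: y star_homD[OF \<iota>1] star_homD[OF \<beta>] scaleC_add_right)
    then show "\<psi> (c *\<^sub>C y) = c *\<^sub>C \<psi> y"
      by (simp only: \<psi>) (simp add: y \<psi> star_homD[OF \<mu>] star_homD[OF \<phi>] scaleC_add_right)
    have "star y = \<beta> (star b) + \<iota>1 (star x)"
      by (simp add: y star_homD[OF \<iota>1] star_homD[OF \<beta>] star_add)
    then show "\<psi> (star y) = star (\<psi> y)"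
      by (simp only: \<psi>) (simp add: y \<psi> star_homD[OF \<mu>] star_homD[OF \<phi>] star_add)
    obtain u where u: "\<beta> b * \<iota>1 x' = \<iota>1 u" "\<phi> b * \<mu> x' = \<mu> u" using mult_left by blast
    obtain v where v: "\<iota>1 x * \<beta> b' = \<iota>1 v" "\<mu> x * \<phi> b' = \<mu> v" using mult_right by blast
    \<comment> \<open>The mixed products lie in the ideal, so they join x * x' in the \<iota>1
      component.\<close>
    have "y * y' = \<beta> (b * b') + \<iota>1 (u + v + x * x')"
      by (simp add: y y' star_homD[OF \<iota>1] star_homD[OF \<beta>] u v algebra_simps)
    then show "\<psi> (y * y') = \<psi> y * \<psi> y'"
      by (simp only: \<psi>) (simp add: y y' \<psi> star_homD[OF \<mu>] star_homD[OF \<phi>] u v algebra_simps)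
  qed
  moreover have "\<psi> (\<beta> b) = \<phi> b" for b
    using \<psi>[of b 0] by (simp add: star_hom_zero[OF \<iota>1] star_hom_zero[OF \<mu>])
  moreover have "\<psi> (\<iota>1 x) = \<mu> x" for x
    using \<psi>[of 0 x] by (simp add: star_hom_zero[OF \<beta>] star_hom_zero[OF \<phi>])
  ultimately show thesis using that decomp by blast
qed

theorem theorem3p1:
  fixes \<theta> :: "'a :: cstar_algebra \<Rightarrow> 'a1 :: cstar_algebra"
    and \<tau>B :: "'b :: cstar_algebra \<Rightarrow> 'b"
    and \<tau>B1 :: "'b1 :: cstar_algebra \<Rightarrow> 'b1"
    and \<tau>D :: "'d :: cstar_algebra \<Rightarrow> 'd"
    and \<tau>E :: "'e :: cstar_algebra \<Rightarrow> 'e"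
    and \<iota> :: "'a double \<Rightarrow> 'b" and p :: "'b \<Rightarrow> 'd"
    and \<iota>1 :: "'a1 double \<Rightarrow> 'b1" and p1 :: "'b1 \<Rightarrow> 'd"
    and \<beta> :: "'b \<Rightarrow> 'b1" and \<phi> :: "'b \<Rightarrow> 'e"
  assumes "proper_hom \<theta>"
    and "reflection \<tau>B" and "reflection \<tau>B1" and "reflection \<tau>D" and "reflection \<tau>E"
    and "star_tau_hom flip \<tau>B1 \<iota>1" and "star_tau_hom \<tau>B1 \<tau>D p1" and "short_exact \<iota>1 p1"
    and "star_tau_hom flip \<tau>B \<iota>" and "star_tau_hom \<tau>B \<tau>D p" and "short_exact \<iota> p"
    and "star_tau_hom \<tau>B \<tau>B1 \<beta>"
    and "\<beta> \<circ> \<iota> = \<iota>1 \<circ> double_map \<theta>" and "p1 \<circ> \<beta> = p"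
    and "star_tau_hom \<tau>B \<tau>E \<phi>"
    and "\<exists>l. star_hom l \<and> (\<forall>a. l (\<theta> a) = \<phi> (\<iota> (DSum a (Opp 0))))"
  shows "\<exists>\<psi>. star_tau_hom \<tau>B1 \<tau>E \<psi> \<and> \<psi> \<circ> \<beta> = \<phi>"
proof -
  note \<tau>E = reflectionD[OF \<open>reflection \<tau>E\<close>]
  have hom: "star_hom \<iota>1" "star_hom p1" "star_hom \<iota>" "star_hom p" "star_hom \<beta>" "star_hom \<phi>"
    and \<tau>\<iota>1: "\<iota>1 (flip x) = \<tau>B1 (\<iota>1 x)" and \<tau>\<iota>: "\<iota> (flip z) = \<tau>B (\<iota> z)"
    and \<tau>\<beta>: "\<beta> (\<tau>B b) = \<tau>B1 (\<beta> b)" and \<tau>\<phi>: "\<phi> (\<tau>B b) = \<tau>E (\<phi> b)" for x z b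
    using assms by (simp_all add: star_tau_hom_def)
  have \<beta>\<iota>: "\<beta> (\<iota> z) = \<iota>1 (double_map \<theta> z)" and p\<beta>: "p1 (\<beta> b) = p b" for z b
    using assms(13,14) by (simp_all add: fun_eq_iff)
  obtain l where l: "star_hom l" and l\<theta>: "\<And>a. l (\<theta> a) = \<phi> (\<iota> (DSum a (Opp 0)))"
    using assms(16) by blast
  have \<tau>l\<theta>: "\<tau>E (l (\<theta> a)) = \<phi> (\<iota> (DSum 0 (Opp a)))" for a
    by (simp add: l\<theta> \<tau>\<phi>[symmetric] \<tau>\<iota>[symmetric])
  have zero: "\<phi> (\<iota> 0) = 0"
    by (simp add: star_hom_zero[OF hom(3)] star_hom_zero[OF hom(6)])
  \<comment> \<open>The two summands of the double annihilate each other, and \<phi> and \<iota> are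
    multiplicative.\<close>
  have orth0: "l (\<theta> a) * \<tau>E (l (\<theta> a')) = 0" "\<tau>E (l (\<theta> a')) * l (\<theta> a) = 0" for a a'
    unfolding \<tau>l\<theta> unfolding l\<theta>
    by (simp_all add: star_homD(3)[OF hom(3), symmetric] star_homD(3)[OF hom(6), symmetric]
        double_simps(2) double_simps(5)[symmetric] zero)
  \<comment> \<open>Both factorizations are on the right: \<tau>E reverses the product \<theta> a'
    behind b', so the two \<theta> factors meet in the middle. In \<open>orth2\<close> the factors
    are swapped and left factorizations are used.\<close>
  have orth1: "l x * \<tau>E (l y) = 0" for x y
  proof -
    obtain a b where x: "x = b * \<theta> a" using proper_hom_right[OF assms(1)] by blast
    obtain a' b' where y: "y = b' * \<theta> a'" using proper_hom_right[OF assms(1)] by blast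
    have "l x * \<tau>E (l y) = l b * (l (\<theta> a) * \<tau>E (l (\<theta> a'))) * \<tau>E (l b')"
      by (simp add: x y star_homD[OF l] \<tau>E mult.assoc)
    then show ?thesis by (simp add: orth0)
  qed
  have orth2: "\<tau>E (l y) * l x = 0" for x y
  proof -
    obtain a b where x: "x = \<theta> a * b" using proper_hom_left[OF assms(1)] by blast
    obtain a' b' where y: "y = \<theta> a' * b'" using proper_hom_left[OF assms(1)] by blast
    have "\<tau>E (l y) * l x = \<tau>E (l b') * (\<tau>E (l (\<theta> a')) * l (\<theta> a)) * l b"
      by (simp add: x y star_homD[OF l] \<tau>E mult.assoc)
    then show ?thesis by (simp add: orth0)
  qed
  \<comment> \<open>On the opposite summand l reverses products; composing with the
    antimultiplicative \<tau>E restores the order.\<close>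
  define \<mu> where "\<mu> x = l (dfst x) + \<tau>E (l (unopp (dsnd x)))" for x
  have \<mu>: "\<mu> (DSum x (Opp y)) = l x + \<tau>E (l y)" for x y
    by (simp add: \<mu>_def)
  have \<mu>hom: "star_hom \<mu>"
    unfolding star_hom_def
  proof (intro conjI allI)
    fix x y :: "'a1 double" and c
    obtain a b where x: "x = DSum a (Opp b)" by (rule double_cases)
    obtain a' b' where y: "y = DSum a' (Opp b')" by (rule double_cases)
    \<comment> \<open>In the product case the two cross terms vanish by \<open>orth1\<close> and
      \<open>orth2\<close>.\<close>
    show "\<mu> (x + y) = \<mu> x + \<mu> y" "\<mu> (c *\<^sub>C x) = c *\<^sub>C \<mu> x"
      "\<mu> (x * y) = \<mu> x * \<mu> y" "\<mu> (star x) = star (\<mu> x)"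
      by (simp_all add: x y double_simps \<mu> star_homD[OF l] \<tau>E star_add scaleC_add_right
          distrib_left distrib_right orth1 orth2)
  qed
  have \<mu>\<theta>: "\<mu> (double_map \<theta> z) = \<phi> (\<iota> z)" for z
  proof -
    obtain a b where z: "z = DSum a (Opp b)" by (rule double_cases)
    show ?thesis
      by (simp add: z \<mu> \<tau>l\<theta>)
        (simp add: l\<theta> star_homD(1)[OF hom(3), symmetric]
          star_homD(1)[OF hom(6), symmetric] double_simps(1))
  qed
  \<comment> \<open>Flipping exchanges the two terms of \<mu>, and so does \<tau>E because it is
    involutive.\<close>
  have \<mu>flip: "\<mu> (flip x) = \<tau>E (\<mu> x)" for x
    by (cases x rule: flip.cases) (simp add: \<mu> \<tau>E add.commute)
  obtain \<psi> where \<psi>: "star_hom \<psi>" and \<psi>\<beta>: "\<And>b. \<psi> (\<beta> b) = \<phi> b"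
    and \<psi>\<iota>1: "\<And>x. \<psi> (\<iota>1 x) = \<mu> x" and decomp: "\<And>y. \<exists>b x. y = \<beta> b + \<iota>1 x"
    using short_exact_pushout[OF proper_hom_double_map[OF assms(1)] hom(1,2) assms(8) hom(3,4)
        assms(11) hom(5) \<beta>\<iota> p\<beta> hom(6) \<mu>hom \<mu>\<theta>] by blast
  \<comment> \<open>\<tau>B1 preserves both the range of \<beta> and the ideal, so compatibility
    reduces to that of \<phi> and \<mu>.\<close>
  have "\<psi> (\<tau>B1 y) = \<tau>E (\<psi> y)" for y
  proof -
    obtain b x where y: "y = \<beta> b + \<iota>1 x" using decomp by blast
    have "\<tau>B1 y = \<beta> (\<tau>B b) + \<iota>1 (flip x)"
      by (simp add: y reflectionD[OF assms(3)] \<tau>\<beta> \<tau>\<iota>1)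
    then show ?thesis
      by (simp add: y star_homD[OF \<psi>] \<psi>\<beta> \<psi>\<iota>1 \<mu>flip \<tau>\<phi> \<tau>E)
  qed
  then have "star_tau_hom \<tau>B1 \<tau>E \<psi> \<and> \<psi> \<circ> \<beta> = \<phi>"
    using \<psi> by (simp add: star_tau_hom_def fun_eq_iff \<psi>\<beta>)
  then show ?thesis by blast
qed

end
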